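(* Let $d\ge1$ be an integer, let $0\le s_j<1$ for $1\le j\le d$, and let $\pi(\beta)=\prod_{j=1}^d2^{s_jd_T(\beta_j)}$, $\beta\in T^d$, be a standard polynomial weight. Then there is a constant $C\ge1$ depending only on $d$ and $\pi$ such that for every Borel measure $\mu\ge0$ on $\overline{T}^d$ with finite energy $\mathcal{E}_\pi[\mu]<\infty$, with boundary push-down $\mu_b$, $$C^{-1}\,\mathbb{V}_\pi^{\mu_b}(\alpha)\le\mathbb{V}_\pi^{\mu}(\alpha)\le C\,\mathbb{V}_\pi^{\mu_b}(\alpha)\qquad\text{for all }\alpha\in\overline{T}^d.$$
   Context: $T$ denotes the (vertex set of the) rooted infinite binary tree with root $o$, in which every vertex has exactly two children. $\partial T$ is the set of infinite descending paths starting at $o$, and $\overline{T}=T\cup\partial T$. For $\alpha,\beta\in T$ write $\alpha\le\beta$ if $\beta$ lies on the geodesic from $o$ to $\alpha$ (so $o$ is the largest element); for $\omega\in\partial T$, $\omega\le\alpha$ means that $\alpha$ is a vertex on the path $\omega$, or $\alpha=\omega$. For $\alpha,\beta\in\overline{T}$, $\alpha\wedge\beta$ is their least common ancestor (with $\alpha\wedge\alpha=\alpha$), and $d_T(\alpha)$ is the number of vertices $\gamma\in T$ with $\gamma\ge\alpha$ (so $d_T(o)=1$, and $d_T(\omega)=\infty$ for $\omega\in\partial T$). $T^d$, $(\partial T)^d$ and $\overline{T}^d$ are the $d$-fold Cartesian products of $T$, $\partial T$ and $\overline{T}$, with the coordinatewise order. For $\beta\in\overline{T}^d$, $\mathcal{S}(\beta)=\{\alpha\in\overline{T}^d:\alpha\le\beta\}$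 and $\partial\mathcal{S}(\beta)=\mathcal{S}(\beta)\cap(\partial T)^d$ (the same notation is used for $d=1$). $\overline{T}^d$ carries the topology (and Borel sets) of the metric $\delta(\alpha,\beta)=\sum_{j=1}^d\big(2^{-d_T(\alpha_j\wedge\beta_j)}-\tfrac12(2^{-d_T(\alpha_j)}+2^{-d_T(\beta_j)})\big)$, where $2^{-\infty}=0$. For $f:T^d\to[0,\infty)$ put $(\mathbb{I}f)(\alpha)=\sum_{\gamma\in T^d,\gamma\ge\alpha}f(\gamma)\pi(\gamma)$, $\alpha\in\overline{T}^d$; for a Borel measure $\mu\ge0$ on $\overline{T}^d$ put $(\mathbb{I}^*\mu)(\beta)=\mu(\mathcal{S}(\beta))$, $\beta\in T^d$. The potential of $\mu$ is $\mathbb{V}^\mu_\pi=\mathbb{I}(\mathbb{I}^*\mu)$ and its energy is $\mathcal{E}_\pi[\mu]=\sum_{\alpha\in T^d}(\mathbb{I}^*\mu)(\alpha)^2\pi(\alpha)$. $M$ is the Borel probability measure on $\partial T$ determined by $M(\partial\mathcal{S}(\alpha))=2^{-d_T(\alpha)+1}$ for $\alpha\in T$. Boundary push-down $\mu_b$ of $\mu$: in each coordinate the mass sitting at a vertex is spread uniformly (with respect to $M$) over the boundary of its successor set, and boundary coordinates are left unchanged. Precisely, for $t\in\overline{T}$ let $p_t$ be the probability measure on $\partial T$ given by $p_t=\delta_t$ (unit point mass) if $t\in\partial T$, and $p_t=M(\partial\mathcal{S}(t))^{-1}\,M|_{\partial\mathcal{S}(t)}$ if $t\in T$. Then for Borel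 $F\subset(\partial T)^d$, $$\mu_b(F)=\int_{\overline{T}^d}(p_{\tau_1}\otimes\dots\otimes p_{\tau_d})(F)\,d\mu(\tau).$$ $\mu_b$ is regarded as a measure on $\overline{T}^d$ supported on $(\partial T)^d$. *)

theory Defs
  imports "HOL-Probability.Probability" "HOL-Library.Sublist"
begin

section \<open>The compactified binary tree\<close>

text \<open>A vertex is the word of left/right choices leading to it from the root \<open>Vertex []\<close>;
  a boundary point, i.e. an infinite descending path from the root, is the infinite
  sequence of its choices.\<close>

datatype tbar = Vertex "bool list" | Ray "nat \<Rightarrow> bool"

definition tverts :: "tbar set" where "tverts = range Vertex"

definition tbdry :: "tbar set" where "tbdry = range Ray"

text \<open>The root is the largest element: \<open>x \<le> y\<close> means that \<open>y\<close> lies on the path from the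
  root to \<open>x\<close>.\<close>

fun tbar_le :: "tbar \<Rightarrow> tbar \<Rightarrow> bool" where
  "tbar_le (Vertex u) (Vertex v) = prefix v u"
| "tbar_le (Ray \<omega>) (Vertex v) = (v = map \<omega> [0..<length v])"
| "tbar_le (Ray \<omega>) (Ray \<omega>') = (\<omega> = \<omega>')"
| "tbar_le (Vertex u) (Ray \<omega>) = False"

lemma prefix_map_upt_iff:
  "prefix u (map f [0..<n]) \<longleftrightarrow> length u \<le> n \<and> u = map f [0..<length u]"
proof
  assume p: "prefix u (map f [0..<n])"
  then have l: "length u \<le> n" using prefix_length_le by fastforce
  have "u = take (length u) (map f [0..<n])"
    using p by (metis append_eq_conv_conj prefix_def)
  also have "\<dots> = map f [0..<length u]" using l by (simp add: take_map)
  finally show "length u \<le> n \<and> u = map f [0..<length u]" using l by simp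
next
  assume a: "length u \<le> n \<and> u = map f [0..<length u]"
  then have "map f [0..<n] = map f [0..<length u] @ map f [length u..<n]"
    using upt_add_eq_append[of 0 "length u" "n - length u"] by simp
  with a show "prefix u (map f [0..<n])" by (metis prefixI)
qed

instantiation tbar :: order
begin

definition less_eq_tbar :: "tbar \<Rightarrow> tbar \<Rightarrow> bool" where "less_eq_tbar = tbar_le"

definition less_tbar :: "tbar \<Rightarrow> tbar \<Rightarrow> bool" where "less_tbar x y \<longleftrightarrow> x \<le> y \<and> \<not> y \<le> x"

instance
proof
  fix x y z :: tbar
  show "x < y \<longleftrightarrow> x \<le> y \<and> \<not> y \<le> x" by (simp add: less_tbar_def)
  show "x \<le> x" by (cases x) (auto simp: less_eq_tbar_def)
  show "x \<le> y \<Longrightarrow> y \<le> z \<Longrightarrow> x \<le> z"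
    by (cases x; cases y; cases z; simp add: less_eq_tbar_def)
       (metis prefix_order.trans prefix_map_upt_iff)+
  show "x \<le> y \<Longrightarrow> y \<le> x \<Longrightarrow> x = y"
    by (cases x; cases y) (auto simp: less_eq_tbar_def)
qed

end

lemma tbar_le_simps [simp]:
  "Vertex u \<le> Vertex v \<longleftrightarrow> prefix v u"
  "Ray \<omega> \<le> Vertex v \<longleftrightarrow> v = map \<omega> [0..<length v]"
  "Ray \<omega> \<le> Ray \<omega>' \<longleftrightarrow> \<omega> = \<omega>'"
  "\<not> Vertex u \<le> Ray \<omega>"
  by (auto simp: less_eq_tbar_def simp del: prefix_order.eq_iff)

lemma le_Ray_iff: "x \<le> Ray \<omega> \<longleftrightarrow> x = Ray \<omega>"
  by (cases x) auto

text \<open>Least common ancestor: as the root is the top of the order, this is the supremum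
  (lemma \<open>lca_le_iff\<close>).\<close>

definition lca :: "tbar \<Rightarrow> tbar \<Rightarrow> tbar" where
  "lca x y = (LEAST z. x \<le> z \<and> y \<le> z)"

definition dT :: "tbar \<Rightarrow> enat" where
  "dT x = (if finite {z \<in> tverts. x \<le> z} then enat (card {z \<in> tverts. x \<le> z}) else \<infinity>)"

text \<open>The function taking \<open>n\<close> to \<open>2\<^sup>-\<^sup>n\<close>, with value \<open>0\<close> at infinity.\<close>

definition pow2neg :: "enat \<Rightarrow> real" where
  "pow2neg n = (case n of enat k \<Rightarrow> 1 / 2 ^ k | \<infinity> \<Rightarrow> 0)"

lemma dT_Vertex [simp]: "dT (Vertex v) = enat (Suc (length v))"
proof -
  have "{z \<in> tverts. Vertex v \<le> z} = Vertex ` set (prefixes v)"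
    by (auto simp: tverts_def)
  moreover have "card (Vertex ` set (prefixes v)) = Suc (length v)"
    by (subst card_image) (auto simp: inj_on_def distinct_card)
  ultimately show ?thesis by (simp add: dT_def)
qed

lemma dT_Ray [simp]: "dT (Ray \<omega>) = \<infinity>"
proof -
  have "range (\<lambda>n. Vertex (map \<omega> [0..<n])) \<subseteq> {z \<in> tverts. Ray \<omega> \<le> z}"
    by (auto simp: tverts_def)
  moreover have "inj (\<lambda>n. Vertex (map \<omega> [0..<n]))"
    by (rule injI) (metis diff_zero length_map length_upt tbar.inject(1))
  ultimately have "infinite {z \<in> tverts. Ray \<omega> \<le> z}"
    by (meson finite_subset range_inj_infinite)
  then show ?thesis by (simp add: dT_def)
qed

lemma chain: assumes "x \<le> a" "x \<le> (b::tbar)" shows "a \<le> b \<or> b \<le> a"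
proof (cases x)
  case (Vertex u)
  then show ?thesis using assms
    by (cases a; cases b) (auto dest: prefix_same_cases)
next
  case (Ray \<omega>)
  show ?thesis
  proof (cases a)
    case (Vertex u)
    show ?thesis
    proof (cases b)
      case b: (Vertex v)
      have u: "u = map \<omega> [0..<length u]" and v: "v = map \<omega> [0..<length v]"
        using assms Ray Vertex b by auto
      then have "prefix u v \<or> prefix v u" by (metis nle_le prefix_map_upt_iff)
      then show ?thesis using Vertex b by auto
    qed (use assms Ray Vertex in auto)
  qed (use assms Ray in auto)
qed

lemma bounded_common:
  assumes "x \<noteq> y"
  shows "\<exists>B. \<forall>u. x \<le> Vertex u \<and> y \<le> Vertex u \<longrightarrow> length u \<le> B"
proof (cases x)
  case (Vertex u)
  then show ?thesis by (auto intro!: exI[of _ "length u"] prefix_length_le)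
next
  case x: (Ray \<omega>)
  show ?thesis
  proof (cases y)
    case (Vertex u)
    then show ?thesis by (auto intro!: exI[of _ "length u"] prefix_length_le)
  next
    case y: (Ray \<omega>')
    then obtain i where i: "\<omega> i \<noteq> \<omega>' i" using x assms by auto
    have "length u \<le> i" if "x \<le> Vertex u" "y \<le> Vertex u" for u
    proof (rule ccontr)
      assume "\<not> length u \<le> i"
      moreover have "map \<omega> [0..<length u] = map \<omega>' [0..<length u]"
        using that x y by (metis tbar_le_simps(2))
      ultimately show False using i by (auto simp: map_eq_conv)
    qed
    then show ?thesis by blast
  qed
qed

lemma lca_exists:
  "\<exists>l. x \<le> l \<and> y \<le> l \<and> (\<forall>z::tbar. x \<le> z \<and> y \<le> z \<longrightarrow> l \<le> z)"
proof (cases "x = y")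
  case False
  let ?P = "\<lambda>u. x \<le> Vertex u \<and> y \<le> Vertex u"
  obtain B where B: "\<forall>u. ?P u \<longrightarrow> length u \<le> B" using bounded_common[OF False] by blast
  have "?P []" by (cases x; cases y) auto
  then obtain u where u: "?P u" "\<forall>v. ?P v \<longrightarrow> length v \<le> length u"
    using ex_has_greatest_nat[of ?P "[]" length "Suc B"] B by (metis (no_types, lifting) less_Suc_eq_le)
  have "Vertex u \<le> z" if z: "x \<le> z" "y \<le> z" for z
  proof (cases z)
    case (Vertex v)
    then have "length v \<le> length u" using u z by blast
    moreover have "Vertex u \<le> z \<or> z \<le> Vertex u" using chain[of x "Vertex u" z] u z by blast
    ultimately show ?thesis unfolding Vertex by (auto elim!: prefixE)
  next
    case (Ray \<omega>)
    then show ?thesis using z False by (auto simp: le_Ray_iff)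
  qed
  then show ?thesis using u by blast
qed auto

lemma lca_le_iff: "lca x y \<le> z \<longleftrightarrow> x \<le> z \<and> y \<le> z"
proof -
  obtain l where l: "x \<le> l" "y \<le> l" "\<And>z. x \<le> z \<Longrightarrow> y \<le> z \<Longrightarrow> l \<le> z"
    using lca_exists[of x y] by blast
  have "lca x y = l" unfolding lca_def by (rule Least_equality) (use l in auto)
  then show ?thesis using l by (meson order_trans)
qed

lemma lca_ge: "x \<le> lca x y" "y \<le> lca x y"
  using lca_le_iff[of x y "lca x y"] by auto

lemma lca_self [simp]: "lca x x = x"
  by (meson lca_ge lca_le_iff order.antisym order.refl)

lemma lca_commute: "lca x y = lca y x"
  by (simp add: lca_def conj_commute)

abbreviation hT :: "tbar \<Rightarrow> real" where "hT x \<equiv> pow2neg (dT x)"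

lemma pow2neg_simps [simp]: "pow2neg (enat n) = (1/2) ^ n" "pow2neg \<infinity> = 0"
  by (simp_all add: pow2neg_def power_one_over)

lemma hT_Vertex: "hT (Vertex v) = (1/2) ^ Suc (length v)"
  by simp

lemma hT_nonneg: "0 \<le> hT x"
  by (cases x) (auto simp: hT_Vertex)

lemma hT_less: assumes "x < y" shows "hT x \<le> hT y / 2"
proof (cases y)
  case (Vertex v)
  show ?thesis
  proof (cases x)
    case x: (Vertex u)
    then have "strict_prefix v u" using assms Vertex
      by (auto simp: less_le strict_prefix_def)
    then have "Suc (length v) \<le> length u" using prefix_length_less by fastforce
    then have "(1/2::real) ^ Suc (length u) \<le> (1/2) ^ Suc (Suc (length v))"
      by (intro power_decreasing) auto
    then show ?thesis using x Vertex by (simp add: hT_Vertex)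
  next
    case (Ray \<omega>)
    then show ?thesis using hT_nonneg[of y] by simp
  qed
next
  case (Ray \<omega>)
  then show ?thesis using assms by (auto simp: less_le le_Ray_iff)
qed

lemma hT_mono: "x \<le> y \<Longrightarrow> hT x \<le> hT y"
  using hT_less[of x y] hT_nonneg[of y] by (cases "x = y") (auto simp: less_le)

lemma lca_pos: assumes "x \<noteq> y" shows "hT (lca x y) > 0"
proof (cases "lca x y")
  case (Ray \<omega>)
  then show ?thesis using lca_ge(1)[of x y] lca_ge(2)[of y x] assms
    by (simp add: le_Ray_iff)
qed (simp add: hT_Vertex)

lemma hT_ultra: "hT (lca x z) \<le> max (hT (lca x y)) (hT (lca y z))"
proof -
  have "lca x y \<le> lca y z \<or> lca y z \<le> lca x y"
    using chain[of y] lca_ge by blast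
  then have "lca x z \<le> lca x y \<or> lca x z \<le> lca y z"
    by (meson lca_ge lca_le_iff order_trans)
  then show ?thesis using hT_mono by (metis le_max_iff_disj)
qed

instantiation tbar :: metric_space
begin

definition dist_tbar :: "tbar \<Rightarrow> tbar \<Rightarrow> real" where
  "dist_tbar x y = pow2neg (dT (lca x y)) - (pow2neg (dT x) + pow2neg (dT y)) / 2"

definition uniformity_tbar :: "(tbar \<times> tbar) filter" where
  "uniformity_tbar = (INF e\<in>{0<..}. principal {(x, y). dist x y < e})"

definition open_tbar :: "tbar set \<Rightarrow> bool" where
  "open_tbar U \<longleftrightarrow> (\<forall>x\<in>U. eventually (\<lambda>(x', y). x' = x \<longrightarrow> y \<in> U) uniformity)"

lemma dist_tbar_lower:
  assumes "x \<noteq> y" shows "dist x y \<ge> hT (lca x y) / 4"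
proof -
  have "x < lca x y \<or> y < lca x y" using lca_ge(1)[of x y] lca_ge(2)[of y x] assms by (metis less_le)
  moreover have "hT x \<le> hT (lca x y)" "hT y \<le> hT (lca x y)" by (auto intro: hT_mono lca_ge)
  ultimately show ?thesis using hT_less[of x "lca x y"] hT_less[of y "lca x y"] hT_nonneg[of "lca x y"]
    unfolding dist_tbar_def by auto
qed

instance
proof
  fix x y z :: tbar
  show "dist x y = 0 \<longleftrightarrow> x = y"
    using dist_tbar_lower[of x y] lca_pos[of x y] by (cases "x = y") (auto simp: dist_tbar_def)
  have "hT z \<le> hT (lca x z)" "hT z \<le> hT (lca z y)" by (auto intro: hT_mono lca_ge)
  then show "dist x y \<le> dist x z + dist y z"
    using hT_ultra[of x y z] unfolding dist_tbar_def lca_commute[of y z]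
    by argo
qed (simp_all add: uniformity_tbar_def open_tbar_def)

end

lemma dist_tbar_upper: "dist x y \<le> hT (lca (x::tbar) y)"
  using hT_nonneg[of x] hT_nonneg[of y] by (simp add: dist_tbar_def)

lemma open_Vertex: "open {Vertex v}"
  unfolding open_dist
proof (intro ballI, simp)
  let ?h = "hT (Vertex v)"
  have "dist y (Vertex v) < ?h / 4 \<longrightarrow> y = Vertex v" for y
    using dist_tbar_lower[of y "Vertex v"] hT_mono[OF lca_ge(2)[of "Vertex v" y]]
    by (cases "y = Vertex v") auto
  moreover have "?h / 4 > 0" by (simp add: hT_Vertex)
  ultimately show "\<exists>e>0. \<forall>y. dist y (Vertex v) < e \<longrightarrow> y = Vertex v" by blast
qed

lemma open_le_Vertex: "open {..Vertex v}"
  unfolding open_dist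
proof (intro ballI)
  fix x assume x: "x \<in> {..Vertex v}"
  let ?h = "hT (Vertex v)"
  have "y \<le> Vertex v" if d: "dist y x < ?h / 4" for y
  proof (cases "y = x")
    case False
    then have "hT (lca y x) < ?h" using dist_tbar_lower[of y x] d by auto
    moreover have "lca y x \<le> Vertex v \<or> Vertex v \<le> lca y x"
      using chain[of x] lca_ge x by auto
    ultimately have "lca y x \<le> Vertex v" using hT_mono by (meson leD)
    then show ?thesis using lca_le_iff by blast
  qed (use x in auto)
  moreover have "?h / 4 > 0" by (simp add: hT_Vertex)
  ultimately show "\<exists>e>0. \<forall>y. dist y x < e \<longrightarrow> y \<in> {..Vertex v}" by blast
qed

definition tbasis :: "tbar set set" where
  "tbasis = insert {} (range (\<lambda>v. {Vertex v}) \<union> range (\<lambda>v. {..Vertex v}))"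

lemma countable_tbasis: "countable tbasis"
  by (auto simp: tbasis_def)

lemma tbasis: "topological_basis tbasis"
proof (rule topological_basisI)
  show "open b" if "b \<in> tbasis" for b
    using that open_Vertex open_le_Vertex by (auto simp: tbasis_def)
  fix U :: "tbar set" and x assume U: "open U" "x \<in> U"
  show "\<exists>b\<in>tbasis. x \<in> b \<and> b \<subseteq> U"
  proof (cases x)
    case (Vertex v)
    then show ?thesis using U by (intro bexI[of _ "{Vertex v}"]) (auto simp: tbasis_def)
  next
    case (Ray \<omega>)
    obtain e where e: "e > 0" "\<And>y. dist y x < e \<Longrightarrow> y \<in> U"
      using U unfolding open_dist by blast
    obtain k where k: "(1/2::real) ^ k < e"
      using real_arch_pow_inv[of e "1/2"] e by auto
    let ?v = "map \<omega> [0..<k]"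
    have "y \<in> U" if y: "y \<le> Vertex ?v" for y
    proof (rule e)
      have "lca y x \<le> Vertex ?v" using y Ray by (simp add: lca_le_iff)
      then have "hT (lca y x) \<le> hT (Vertex ?v)" by (rule hT_mono)
      also have "\<dots> \<le> (1/2) ^ k" by (simp add: hT_Vertex)
      finally show "dist y x < e" using dist_tbar_upper[of y x] k by linarith
    qed
    then show ?thesis using Ray
      by (intro bexI[of _ "{..Vertex ?v}"]) (auto simp: tbasis_def)
  qed
qed

instance tbar :: second_countable_topology
proof
  show "\<exists>B::tbar set set. countable B \<and> open = generate_topology B"
    using countable_tbasis tbasis topological_basis_imp_subbasis by blast
qed

section \<open>Successor sets and the polytree\<close>

text \<open>Points of the \<open>d\<close>-fold product are functions on a finite index type \<open>'n\<close> with
  \<open>CARD('n) = d\<close>, ordered coordinatewise by the library's order on functions.\<close>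

definition Sset :: "'a::order \<Rightarrow> 'a set" where
  "Sset \<beta> = {\<alpha>. \<alpha> \<le> \<beta>}"

definition bSset :: "tbar \<Rightarrow> tbar set" where
  "bSset t = Sset t \<inter> tbdry"

definition Tprod :: "('n::finite \<Rightarrow> tbar) set" where
  "Tprod = {\<gamma>. \<forall>j. \<gamma> j \<in> tverts}"

definition delta :: "('n::finite \<Rightarrow> tbar) \<Rightarrow> ('n \<Rightarrow> tbar) \<Rightarrow> real" where
  "delta \<alpha> \<beta> = (\<Sum>j\<in>UNIV. pow2neg (dT (lca (\<alpha> j) (\<beta> j)))
      - (pow2neg (dT (\<alpha> j)) + pow2neg (dT (\<beta> j))) / 2)"

definition poly_borel :: "('n::finite \<Rightarrow> tbar) measure" where
  "poly_borel = sigma UNIV {U. openin (Metric_space.mtopology UNIV delta) U}"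

lemma delta_conv_dist: "delta \<alpha> \<beta> = (\<Sum>j\<in>UNIV. dist (\<alpha> j) (\<beta> j))"
  by (simp add: delta_def dist_tbar_def)

lemma Metric_space_delta: "Metric_space UNIV (delta :: ('n::finite \<Rightarrow> tbar) \<Rightarrow> _)"
proof
  fix x y z :: "'n \<Rightarrow> tbar"
  show "0 \<le> delta x y" by (simp add: delta_conv_dist sum_nonneg)
  show "delta x y = delta y x" by (simp add: delta_conv_dist dist_commute)
  show "delta x y = 0 \<longleftrightarrow> x = y" by (auto simp: delta_conv_dist sum_nonneg_eq_0_iff)
  show "delta x z \<le> delta x y + delta y z"
    unfolding delta_conv_dist sum.distrib[symmetric] by (intro sum_mono dist_triangle)
qed

text \<open>The topology of \<open>delta\<close> is the product topology that the library puts on functions.\<close>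

lemma openin_delta_iff:
  fixes U :: "('n::finite \<Rightarrow> tbar) set"
  shows "openin (Metric_space.mtopology UNIV delta) U \<longleftrightarrow> open U"
proof -
  interpret D: Metric_space UNIV "delta :: ('n \<Rightarrow> tbar) \<Rightarrow> _" by (rule Metric_space_delta)
  have "openin D.mtopology U \<longleftrightarrow> (\<forall>x\<in>U. \<exists>r>0. \<forall>y. delta x y < r \<longrightarrow> y \<in> U)"
    by (auto simp: D.openin_mtopology subset_iff)
  also have "\<dots> \<longleftrightarrow> open U"
  proof
    assume R: "\<forall>x\<in>U. \<exists>r>0. \<forall>y. delta x y < r \<longrightarrow> y \<in> U"
    show "open U"
    proof (subst open_subopen, intro ballI)
      fix x assume "x \<in> U"
      then obtain r where r: "r > 0" "\<And>y. delta x y < r \<Longrightarrow> y \<in> U" using R by blast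
      let ?r = "r / (real CARD('n))"
      let ?B = "PiE UNIV (\<lambda>j. ball (x j) ?r)"
      have "open ?B" by (intro open_PiE) auto
      moreover have "x \<in> ?B" using r by auto
      moreover have "?B \<subseteq> U"
      proof
        fix y assume y: "y \<in> ?B"
        have "delta x y < (\<Sum>j\<in>(UNIV::'n set). ?r)" unfolding delta_conv_dist
          by (intro sum_strict_mono) (use y in auto)
        then show "y \<in> U" using r by simp
      qed
      ultimately show "\<exists>T. open T \<and> x \<in> T \<and> T \<subseteq> U" by blast
    qed
  next
    assume o: "open U"
    show "\<forall>x\<in>U. \<exists>r>0. \<forall>y. delta x y < r \<longrightarrow> y \<in> U"
    proof
      fix x assume x: "x \<in> U"
      obtain X where X: "x \<in> PiE UNIV X" "\<And>i. open (X i)" "PiE UNIV X \<subseteq> U"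
        using product_topology_open_contains_basis[OF o[unfolded open_fun_def] x] by auto
      have "\<exists>e>0. \<forall>y. dist y (x i) < e \<longrightarrow> y \<in> X i" for i
        using X(1) X(2)[of i] unfolding open_dist by auto
      then obtain e where e: "\<And>i. e i > 0" "\<And>i y. dist y (x i) < e i \<Longrightarrow> y \<in> X i" by metis
      have "y \<in> U" if d: "delta x y < Min (range e)" for y
      proof -
        have "dist (y i) (x i) < e i" for i
        proof -
          have "dist (x i) (y i) \<le> delta x y" unfolding delta_conv_dist
            by (rule member_le_sum) auto
          moreover have "Min (range e) \<le> e i" by simp
          ultimately show ?thesis using d unfolding dist_commute[of "y i"] by linarith
        qed
        then show ?thesis using e X(3) by auto
      qed
      moreover have "Min (range e) > 0" using e by simp
      ultimately show "\<exists>r>0. \<forall>y. delta x y < r \<longrightarrow> y \<in> U" by blast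
    qed
  qed
  finally show ?thesis .
qed

lemma poly_borel_eq_borel: "poly_borel = borel"
  by (simp add: poly_borel_def borel_def openin_delta_iff)

section \<open>The uniform boundary measure and the push-down\<close>

text \<open>Measures on the boundary are rendered as Borel measures on the compactified tree.
  Taking the root for \<open>t\<close> shows that \<open>uniform_bdry\<close> is carried by \<open>tbdry\<close>.\<close>

definition is_uniform_bdry :: "tbar measure \<Rightarrow> bool" where
  "is_uniform_bdry N \<longleftrightarrow> sets N = sets borel \<and> prob_space N \<and>
     (\<forall>t\<in>tverts. emeasure N (bSset t) = ennreal (2 * pow2neg (dT t)))"

definition uniform_bdry :: "tbar measure" where
  "uniform_bdry = (THE N. is_uniform_bdry N)"

lemma countable_tverts: "countable tverts" by (simp add: tverts_def)

lemma tverts_borel: "A \<subseteq> tverts \<Longrightarrow> A \<in> sets borel"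
proof -
  assume A: "A \<subseteq> tverts"
  then have "A = (\<Union>v\<in>{v. Vertex v \<in> A}. {Vertex v})" by (auto simp: tverts_def)
  moreover have "open (\<Union>v\<in>{v. Vertex v \<in> A}. {Vertex v})" by (intro open_UN) (simp add: open_Vertex)
  ultimately show ?thesis by simp
qed

lemma tbdry_compl: "tbdry = - tverts"
  unfolding tbdry_def tverts_def by (auto simp: image_iff) (metis tbar.exhaust)

lemma tbdry_borel [measurable]: "tbdry \<in> sets borel"
  unfolding tbdry_compl using tverts_borel[of tverts] by auto

lemma Sset_Vertex_borel [measurable]: "Sset (Vertex v) \<in> sets borel"
  using open_le_Vertex[of v] by (simp add: Sset_def atMost_def)

lemma bSset_borel [measurable]: "bSset (Vertex v) \<in> sets borel"
  unfolding bSset_def by measurable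

lemma Vertex_nested:
  "{..Vertex u} \<inter> {..Vertex v} \<in> {{}, {..Vertex u}, {..Vertex v}}"
proof (cases "{..Vertex u} \<inter> {..Vertex v} = {}")
  case False
  then have "Vertex u \<le> Vertex v \<or> Vertex v \<le> Vertex u" using chain by blast
  then show ?thesis by (auto intro: order_trans simp del: tbar_le_simps)
qed auto

lemma is_uniform_bdry_unique:
  assumes "is_uniform_bdry M" "is_uniform_bdry N" shows "M = N"
proof (rule measure_eqI_generator_eq[where E = tbasis and \<Omega> = UNIV and A = "\<lambda>_. {..Vertex []}"])
  have borel: "sets borel = sigma_sets UNIV tbasis"
    by (subst borel_eq_countable_basis[OF countable_tbasis tbasis]) simp
  show "Int_stable tbasis"
  proof (rule Int_stableI)
    fix a b assume "a \<in> tbasis" "b \<in> tbasis"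
    then consider "a = {} \<or> b = {}" | v where "a = {Vertex v} \<or> b = {Vertex v}"
      | u v where "a = {..Vertex u}" "b = {..Vertex v}"
      unfolding tbasis_def by auto
    then show "a \<inter> b \<in> tbasis"
    proof cases
      case 2
      then have "a \<inter> b = {} \<or> a \<inter> b = {Vertex v}" by auto
      then show ?thesis by (auto simp: tbasis_def)
    next
      case 3
      then show ?thesis using Vertex_nested[of u v] by (auto simp: tbasis_def)
    qed (auto simp: tbasis_def)
  qed
  show "sets M = sigma_sets UNIV tbasis" "sets N = sigma_sets UNIV tbasis"
    using assms borel by (auto simp: is_uniform_bdry_def)
  have root: "bSset (Vertex []) = tbdry"
    unfolding bSset_def Sset_def tbdry_def by auto
  have val: "emeasure L (tverts \<inter> A) = 0" "emeasure L {..Vertex v} = ennreal (2 * hT (Vertex v))"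
    if L: "is_uniform_bdry L" for L A v
  proof -
    interpret prob_space L using L by (simp add: is_uniform_bdry_def)
    have s[measurable_cong]: "sets L = sets borel" using L by (simp add: is_uniform_bdry_def)
    have sp: "space L = UNIV" using sets_eq_imp_space_eq[OF s] by simp
    have "emeasure L (bSset (Vertex [])) = ennreal (2 * hT (Vertex []))"
      using L unfolding is_uniform_bdry_def by (auto simp: tverts_def)
    then have "emeasure L tbdry = 1" by (simp add: root hT_Vertex)
    then have "AE x in L. x \<in> tbdry"
      by (intro AE_I_eq_1) (auto simp: sp s)
    then have ae: "AE x in L. x \<notin> tverts" by (simp add: tbdry_compl)
    have T: "tverts \<inter> A \<in> sets L" "tverts \<in> sets L" using tverts_borel s by auto
    have "AE x in L. x \<notin> tverts \<inter> A" using ae by eventually_elim auto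
    then show "emeasure L (tverts \<inter> A) = 0"
      using AE_iff_null_sets[OF T(1)] by (metis null_setsD1)
    have "emeasure L {..Vertex v} = emeasure L (bSset (Vertex v))"
    proof (rule emeasure_eq_AE)
      show "AE x in L. x \<in> {..Vertex v} \<longleftrightarrow> x \<in> bSset (Vertex v)"
        using ae by eventually_elim (auto simp: bSset_def Sset_def tbdry_compl)
      show "{..Vertex v} \<in> sets L" "bSset (Vertex v) \<in> sets L"
        using open_le_Vertex bSset_borel by (auto simp: s)
    qed
    then show "emeasure L {..Vertex v} = ennreal (2 * hT (Vertex v))"
      using L unfolding is_uniform_bdry_def by (auto simp: tverts_def)
  qed
  show "emeasure M X = emeasure N X" if "X \<in> tbasis" for X
  proof -
    consider "X = {}" | v where "X = tverts \<inter> {Vertex v}" | v where "X = {..Vertex v}"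
      using \<open>X \<in> tbasis\<close> unfolding tbasis_def by (auto simp: tverts_def)
    then show ?thesis using val assms by cases auto
  qed
  show "(\<Union>i. {..Vertex []}) = UNIV"
  proof (auto)
    fix x show "x \<le> Vertex []" by (cases x) auto
  qed
  show "emeasure M {..Vertex []} \<noteq> \<infinity>" for i :: nat using val assms by auto
qed (auto simp: tbasis_def)

lemma is_uniform_bdry_exists: "\<exists>N. is_uniform_bdry N"
proof -
  let ?c = "uniform_count_measure (UNIV :: bool set)"
  have pc: "prob_space ?c" by (rule prob_space_uniform_count_measure) auto
  define P where "P = (\<Pi>\<^sub>M i\<in>(UNIV::nat set). ?c)"
  interpret product_prob_space "\<lambda>_::nat. ?c" UNIV
    by (intro product_prob_spaceI pc)
  have spP: "space P = UNIV" by (auto simp: P_def space_PiM space_uniform_count_measure)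
  have cyl: "Ray -` {..Vertex v} = {x \<in> space P. \<forall>i\<in>{..<length v}. x i \<in> {v ! i}}" for v
  proof -
    have "Ray x \<le> Vertex v \<longleftrightarrow> (\<forall>i<length v. v ! i = x i)" for x
      unfolding tbar_le_simps by (subst list_eq_iff_nth_eq) simp
    then show ?thesis by (auto simp del: tbar_le_simps simp add: spP vimage_def)
  qed
  have cylm: "Ray -` {..Vertex v} \<in> sets P" for v
  proof -
    have "{x \<in> space P. x i \<in> {v ! i}} \<in> sets P" for i
      unfolding P_def by (rule measurable_sets_Collect[OF measurable_component_singleton]) auto
    then show ?thesis unfolding cyl by (intro sets.sets_Collect_finite_All) auto
  qed
  have Rm: "Ray \<in> measurable P borel"
    unfolding borel_eq_countable_basis[OF countable_tbasis tbasis]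
  proof (rule measurable_measure_of)
    fix y assume "y \<in> tbasis"
    then consider "y = {}" | v where "y = {Vertex v}" | v where "y = {..Vertex v}"
      by (auto simp: tbasis_def)
    then show "Ray -` y \<inter> space P \<in> sets P"
    proof cases
      case 2
      then have "Ray -` y = {}" by auto
      then show ?thesis by simp
    qed (auto simp: spP cylm)
  qed auto
  let ?N = "distr P borel Ray"
  have "prob_space P" unfolding P_def by (rule prob_space_PiM) (rule pc)
  then have "prob_space ?N" using Rm by (rule prob_space.prob_space_distr)
  moreover have "emeasure ?N (bSset t) = ennreal (2 * hT t)" if t: "t \<in> tverts" for t
  proof -
    obtain v where v: "t = Vertex v" using t by (auto simp: tverts_def)
    have "Ray -` bSset t = Ray -` {..Vertex v}"
      unfolding v bSset_def Sset_def tbdry_def by auto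
    then have "emeasure ?N (bSset t) = emeasure P {x \<in> space P. \<forall>i\<in>{..<length v}. x i \<in> {v ! i}}"
      using v by (subst emeasure_distr[OF Rm]) (auto simp: spP cyl)
    also have "\<dots> = (\<Prod>i<length v. emeasure ?c {v ! i})"
      unfolding P_def by (rule emeasure_PiM_Collect) auto
    also have "\<dots> = (\<Prod>i<length v. ennreal (1/2))"
      by (intro prod.cong refl) (subst emeasure_uniform_count_measure, auto)
    also have "\<dots> = ennreal (2 * hT t)"
    proof -
      have "2 * hT t = (1/2) ^ length v" by (simp add: v)
      moreover have "ennreal (1/2) ^ length v = ennreal ((1/2) ^ length v)"
        by (rule ennreal_power) simp
      ultimately show ?thesis by (simp only: prod_constant card_lessThan)
    qed
    finally show ?thesis .
  qed
  ultimately show ?thesis by (intro exI[of _ ?N]) (simp add: is_uniform_bdry_def)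
qed

lemma is_uniform_bdry: "is_uniform_bdry uniform_bdry"
  unfolding uniform_bdry_def
  using is_uniform_bdry_exists is_uniform_bdry_unique by (metis theI')

definition spread :: "tbar \<Rightarrow> tbar measure" where
  "spread t = (if t \<in> tbdry then return borel t else uniform_measure uniform_bdry (bSset t))"

definition push_down :: "('n::finite \<Rightarrow> tbar) measure \<Rightarrow> ('n \<Rightarrow> tbar) measure" where
  "push_down \<mu> = measure_of UNIV (sets poly_borel)
     (\<lambda>F. \<integral>\<^sup>+ \<tau>. emeasure (\<Pi>\<^sub>M j\<in>UNIV. spread (\<tau> j)) F \<partial>\<mu>)"

lemma sets_uniform_bdry [measurable_cong]: "sets uniform_bdry = sets borel"
  using is_uniform_bdry by (simp add: is_uniform_bdry_def)

lemma emeasure_bSset: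
  assumes "t \<in> tverts" shows "emeasure uniform_bdry (bSset t) = ennreal (2 * hT t)"
  using is_uniform_bdry assms by (simp add: is_uniform_bdry_def)

lemma sets_spread [simp, measurable_cong]: "sets (spread t) = sets borel"
  by (simp add: spread_def sets_uniform_bdry)

lemma space_spread [simp]: "space (spread t) = UNIV"
  using sets_eq_imp_space_eq[OF sets_spread] by simp

lemma prob_space_spread: "prob_space (spread t)"
proof (cases t)
  case (Vertex v)
  then have "t \<notin> tbdry" "t \<in> tverts" by (auto simp: tbdry_def tverts_def)
  moreover have "0 < hT t" by (simp add: Vertex hT_Vertex)
  ultimately show ?thesis unfolding spread_def
    by (simp add: emeasure_bSset prob_space_uniform_measure)
next
  case (Ray \<omega>)
  then show ?thesis by (auto simp: spread_def tbdry_def intro: prob_space_return)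
qed

lemma spread_tbdry: "emeasure (spread t) tbdry = 1"
proof (cases t)
  case (Vertex v)
  have pos: "0 < hT t" by (simp add: Vertex hT_Vertex)
  have t: "t \<notin> tbdry" "t \<in> tverts" using Vertex by (auto simp: tbdry_def tverts_def)
  have "bSset t \<inter> tbdry = bSset t" by (auto simp: bSset_def)
  then have "emeasure (spread t) tbdry
      = emeasure uniform_bdry (bSset t) / emeasure uniform_bdry (bSset t)"
    using t Vertex by (simp add: spread_def sets_uniform_bdry)
  also have "\<dots> = 1" using t pos by (simp add: emeasure_bSset ennreal_divide_self)
  finally show ?thesis .
next
  case (Ray \<omega>)
  then have "t \<in> tbdry" by (simp add: tbdry_def)
  then show ?thesis by (simp add: spread_def tbdry_borel)
qed

lemma sets_PiM_spread:
  "sets (\<Pi>\<^sub>M j\<in>(UNIV::'n::finite set). spread (\<tau> j)) = sets poly_borel"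
  unfolding poly_borel_eq_borel sets_PiM_equal_borel[symmetric]
  by (rule sets_PiM_cong) auto

lemma measurable_spread:
  assumes "A \<in> sets borel" shows "(\<lambda>t. emeasure (spread t) A) \<in> borel_measurable borel"
proof (rule measurable_discrete_difference[where X = tverts])
  show "indicator A \<in> borel_measurable (borel :: tbar measure)" using assms by measurable
  show "{x} \<in> sets borel" if "x \<in> tverts" for x :: tbar by simp
  show "indicator A x = emeasure (spread x) A" if "x \<notin> tverts" for x :: tbar
    using that assms by (simp add: spread_def tbdry_compl)
qed (auto simp: countable_tverts)

lemma measurable_spread_PiM:
  fixes F :: "('n::finite \<Rightarrow> tbar) set"
  assumes "F \<in> sets poly_borel"
  shows "(\<lambda>\<tau>. emeasure (\<Pi>\<^sub>M j\<in>UNIV. spread (\<tau> j)) F) \<in> borel_measurable poly_borel"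
proof -
  let ?P = "\<lambda>\<tau>::'n \<Rightarrow> tbar. \<Pi>\<^sub>M j\<in>UNIV. spread (\<tau> j)"
  let ?B = "\<Pi>\<^sub>M j\<in>(UNIV::'n set). (borel :: tbar measure)"
  have sB: "sets ?B = sets poly_borel"
    by (simp add: poly_borel_eq_borel sets_PiM_equal_borel)
  have sP: "sets (?P \<tau>) = sets ?B" for \<tau>
    by (simp add: sets_PiM_spread sB)
  have prP: "prob_space (?P \<tau>)" for \<tau>
    by (rule prob_space_PiM) (rule prob_space_spread)
  have spP: "space (?P \<tau>) = UNIV" for \<tau> by (auto simp: space_PiM)
  have gen: "sets ?B = sigma_sets (\<Pi>\<^sub>E j\<in>UNIV. space borel) (prod_algebra UNIV (\<lambda>_. borel))"
    by (rule sets_PiM)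
  have "(\<lambda>\<tau>. emeasure (?P \<tau>) F) \<in> borel_measurable ?B"
    using assms[folded sB, unfolded gen]
  proof (induction rule: sigma_sets_induct_disjoint[OF Int_stable_prod_algebra
        prod_algebra_sets_into_space, consumes 1, case_names basic empty compl union])
    case (basic A)
    then obtain X where X: "A = PiE UNIV X" "\<And>j. X j \<in> sets borel"
      by (auto simp: prod_algebra_eq_finite)
    have "emeasure (?P \<tau>) A = (\<Prod>j\<in>UNIV. emeasure (spread (\<tau> j)) (X j))" for \<tau>
    proof -
      interpret product_prob_space "\<lambda>j. spread (\<tau> j)" "UNIV :: 'n set"
        by (intro product_prob_spaceI prob_space_spread)
      show ?thesis unfolding X(1) by (rule emeasure_PiM) (use X in auto)
    qed
    moreover have "(\<lambda>\<tau>. emeasure (spread (\<tau> j)) (X j)) \<in> borel_measurable ?B" for j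
      using measurable_compose[OF measurable_component_singleton[of j UNIV "\<lambda>_. borel"]
          measurable_spread[OF X(2)[of j]]] by simp
    ultimately show ?case by simp
  next
    case empty
    then show ?case by simp
  next
    case (compl A)
    have A: "A \<in> sets ?B" using compl.hyps gen by blast
    have "emeasure (?P \<tau>) ((\<Pi>\<^sub>E j\<in>UNIV. space borel) - A) = 1 - emeasure (?P \<tau>) A" for \<tau>
    proof -
      interpret prob_space "?P \<tau>" by (rule prP)
      have "(\<Pi>\<^sub>E j\<in>UNIV. space borel) - A = space (?P \<tau>) - A" by (auto simp: spP)
      then show ?thesis using A sP[of \<tau>] by (simp add: emeasure_compl emeasure_space_1)
    qed
    then show ?case using compl by simp
  next
    case (union A)
    have "range A \<subseteq> sets ?B" using union.hyps gen by blast
    then have "emeasure (?P \<tau>) (\<Union>i. A i) = (\<Sum>i. emeasure (?P \<tau>) (A i))" for \<tau>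
      using union.hyps sP[of \<tau>] by (intro suminf_emeasure[symmetric]) auto
    then show ?case using union by simp
  qed
  then show ?thesis using measurable_cong_sets[OF sB refl] by blast
qed

text \<open>The set function in \<open>push_down\<close> is a measure, so \<open>push_down\<close> has the intended values.\<close>

lemma sets_push_down [simp]: "sets (push_down \<mu>) = sets poly_borel"
proof -
  have "space (poly_borel :: ('a \<Rightarrow> tbar) measure) = UNIV"
    by (simp add: poly_borel_eq_borel)
  then show ?thesis unfolding push_down_def
    using sets.sigma_sets_eq[of "poly_borel :: ('a \<Rightarrow> tbar) measure"] by simp
qed

lemma emeasure_push_down:
  fixes \<mu> :: "('n::finite \<Rightarrow> tbar) measure"
  assumes \<mu>: "sets \<mu> = sets poly_borel" and F: "F \<in> sets poly_borel"
  shows "emeasure (push_down \<mu>) F = (\<integral>\<^sup>+ \<tau>. emeasure (\<Pi>\<^sub>M j\<in>UNIV. spread (\<tau> j)) F \<partial>\<mu>)"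
proof (rule emeasure_measure_of[OF push_down_def])
  let ?P = "\<lambda>\<tau>::'n \<Rightarrow> tbar. \<Pi>\<^sub>M j\<in>UNIV. spread (\<tau> j)"
  show "F \<in> sets (push_down \<mu>)" using F by simp
  show "positive (sets (push_down \<mu>)) (\<lambda>F. \<integral>\<^sup>+ \<tau>. emeasure (?P \<tau>) F \<partial>\<mu>)"
    by (simp add: positive_def)
  show "countably_additive (sets (push_down \<mu>)) (\<lambda>F. \<integral>\<^sup>+ \<tau>. emeasure (?P \<tau>) F \<partial>\<mu>)"
  proof (rule countably_additiveI)
    fix A :: "nat \<Rightarrow> ('n \<Rightarrow> tbar) set"
    assume A: "range A \<subseteq> sets (push_down \<mu>)" "disjoint_family A"
    have "(\<lambda>\<tau>. emeasure (?P \<tau>) (A i)) \<in> borel_measurable \<mu>" for i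
      using measurable_spread_PiM[of "A i"] A(1) measurable_cong_sets[OF \<mu> refl] by auto
    then have "(\<Sum>i. \<integral>\<^sup>+ \<tau>. emeasure (?P \<tau>) (A i) \<partial>\<mu>) = (\<integral>\<^sup>+ \<tau>. (\<Sum>i. emeasure (?P \<tau>) (A i)) \<partial>\<mu>)"
      by (intro nn_integral_suminf[symmetric]) 
    also have "\<dots> = (\<integral>\<^sup>+ \<tau>. emeasure (?P \<tau>) (\<Union>i. A i) \<partial>\<mu>)"
      using A by (intro nn_integral_cong suminf_emeasure) (auto simp: sets_PiM_spread)
    finally show "(\<Sum>i. \<integral>\<^sup>+ \<tau>. emeasure (?P \<tau>) (A i) \<partial>\<mu>)
        = (\<integral>\<^sup>+ \<tau>. emeasure (?P \<tau>) (\<Union>i. A i) \<partial>\<mu>)" .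
  qed
qed auto

section \<open>Potential, energy and polynomial weights\<close>

text \<open>Sums over vertices are unordered sums of \<open>[0,\<infinity>]\<close>-valued terms. Values of \<open>f\<close> and \<open>w\<close>
  off \<open>Tprod\<close> are irrelevant.\<close>

definition I_op :: "(('n::finite \<Rightarrow> tbar) \<Rightarrow> real) \<Rightarrow> (('n \<Rightarrow> tbar) \<Rightarrow> ennreal) \<Rightarrow> ('n \<Rightarrow> tbar) \<Rightarrow> ennreal" where
  "I_op w f \<alpha> = (\<integral>\<^sup>+ \<gamma>. f \<gamma> * ennreal (w \<gamma>) \<partial>count_space {\<gamma> \<in> Tprod. \<alpha> \<le> \<gamma>})"

definition I_adj :: "('n::finite \<Rightarrow> tbar) measure \<Rightarrow> ('n \<Rightarrow> tbar) \<Rightarrow> ennreal" where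
  "I_adj \<mu> \<beta> = emeasure \<mu> (Sset \<beta>)"

definition potential :: "(('n::finite \<Rightarrow> tbar) \<Rightarrow> real) \<Rightarrow> ('n \<Rightarrow> tbar) measure \<Rightarrow> ('n \<Rightarrow> tbar) \<Rightarrow> ennreal" where
  "potential w \<mu> = I_op w (I_adj \<mu>)"

definition energy :: "(('n::finite \<Rightarrow> tbar) \<Rightarrow> real) \<Rightarrow> ('n \<Rightarrow> tbar) measure \<Rightarrow> ennreal" where
  "energy w \<mu> = (\<integral>\<^sup>+ \<alpha>. (I_adj \<mu> \<alpha>)\<^sup>2 * ennreal (w \<alpha>) \<partial>count_space Tprod)"

definition poly_weight :: "('n::finite \<Rightarrow> real) \<Rightarrow> ('n \<Rightarrow> tbar) \<Rightarrow> real" where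
  "poly_weight s \<beta> = (\<Prod>j\<in>UNIV. 2 powr (s j * real (the_enat (dT (\<beta> j)))))"

text \<open>Hence \<open>I_adj\<close> never hits the default value \<open>0\<close> of \<open>emeasure\<close> on non-measurable sets.\<close>

lemma Sset_measurable:
  fixes \<beta> :: "'n::finite \<Rightarrow> tbar"
  assumes "\<beta> \<in> Tprod" shows "Sset \<beta> \<in> sets poly_borel"
proof -
  have "Sset \<beta> = PiE UNIV (\<lambda>j. {..\<beta> j})" by (auto simp: Sset_def le_fun_def)
  moreover have "open (PiE UNIV (\<lambda>j. {..\<beta> j}))"
    using assms by (intro open_PiE) (auto simp: Tprod_def tverts_def open_le_Vertex, metis open_le_Vertex rangeE)
  ultimately show ?thesis by (simp add: poly_borel_eq_borel)
qed

end

theory Submission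
  imports Defs
begin

text \<open>Interchanging sum and integral, both potentials are integrals against \<open>\<mu>\<close> of products over
  the coordinates of one-dimensional kernels: with \<open>w c = 2\<^bsup>s d(c)\<^esup>\<close>, the kernel of \<open>\<mu>\<close> at \<open>t\<close> is
  the sum of \<open>w c\<close> over the common ancestors \<open>c\<close> of \<open>a\<close> and \<open>t\<close>, and the kernel of the push-down is
  the sum of \<open>p\<^sub>t (S c) w c\<close> over the ancestors \<open>c\<close> of \<open>a\<close>. The additional terms in the latter come
  from those \<open>c\<close> with \<open>a \<le> c < t\<close>. They lie on a single path descending from \<open>t\<close>, and
  \<open>p\<^sub>t (S c) w c = w t 2\<^bsup>(s - 1)(d(c) - d(t))\<^esup>\<close>, so as \<open>s < 1\<close> they add up to at most a geometric
  series times \<open>w t\<close>, which is itself a term of the former kernel.\<close>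

text \<open>Meant for vertices only: \<open>the_enat\<close> has no specified value at the infinite
  \<open>dT\<close> of a ray. The root has depth 1.\<close>

abbreviation depth :: "tbar \<Rightarrow> nat" where "depth c \<equiv> the_enat (dT c)"

abbreviation vertex_weight :: "real \<Rightarrow> tbar \<Rightarrow> real" where
  "vertex_weight s c \<equiv> 2 powr (s * real (depth c))"

abbreviation ancestors :: "tbar \<Rightarrow> tbar set" where
  "ancestors a \<equiv> {c \<in> tverts. a \<le> c}"

section \<open>Masses of successor sets under the spread of a single point\<close>

lemma emeasure_spread_Ray:
  assumes "A \<in> sets borel" shows "emeasure (spread (Ray \<omega>)) A = indicator A (Ray \<omega>)"
  using assms by (simp add: spread_def tbdry_def)

lemma emeasure_spread_Vertex:
  assumes "A \<in> sets borel"
  shows "emeasure (spread (Vertex u)) A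
    = emeasure uniform_bdry (bSset (Vertex u) \<inter> A) / emeasure uniform_bdry (bSset (Vertex u))"
proof -
  have "Vertex u \<notin> tbdry" by (auto simp: tbdry_def)
  then show ?thesis using assms bSset_borel by (simp add: spread_def sets_uniform_bdry)
qed

text \<open>At a vertex \<open>t\<close> the measure \<open>spread t\<close> is carried by
  \<open>bSset t\<close>, which lies inside \<open>Sset (Vertex v)\<close>; at a ray the point mass
  sits in that set.\<close>

lemma emeasure_spread_ancestor:
  assumes "t \<le> Vertex v" shows "emeasure (spread t) (Sset (Vertex v)) = 1"
proof (cases t)
  case (Ray \<omega>)
  moreover have "t \<in> Sset (Vertex v)" using assms by (simp add: Sset_def)
  ultimately show ?thesis using Sset_Vertex_borel by (simp add: emeasure_spread_Ray)
next
  case (Vertex u)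
  have "bSset t \<inter> Sset (Vertex v) = bSset t"
    using assms by (auto simp: bSset_def Sset_def simp del: tbar_le_simps)
  moreover have "t \<in> tverts" using Vertex by (simp add: tverts_def)
  moreover have "hT t > 0" using Vertex by (simp add: hT_Vertex)
  ultimately show ?thesis using Vertex
    by (simp add: emeasure_spread_Vertex emeasure_bSset ennreal_divide_self)
qed

text \<open>The boundary below \<open>v\<close> is part of the boundary below \<open>u\<close>, so
  the mass is the quotient of their uniform masses: a factor 1/2 for each level from
  \<open>u\<close> down to \<open>v\<close>.\<close>

lemma emeasure_spread_descendant:
  assumes "Vertex v \<le> Vertex u"
  shows "emeasure (spread (Vertex u)) (Sset (Vertex v)) = ennreal ((1/2) ^ (length v - length u))"
proof -
  have p: "length u \<le> length v" using assms by (simp add: prefix_length_le)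
  have "bSset (Vertex u) \<inter> Sset (Vertex v) = bSset (Vertex v)"
    using assms by (auto simp: bSset_def Sset_def simp del: tbar_le_simps)
  moreover have "Vertex u \<in> tverts" "Vertex v \<in> tverts" by (auto simp: tverts_def)
  ultimately have "emeasure (spread (Vertex u)) (Sset (Vertex v))
      = ennreal (2 * hT (Vertex v)) / ennreal (2 * hT (Vertex u))"
    by (simp add: emeasure_spread_Vertex emeasure_bSset)
  also have "\<dots> = ennreal ((2 * hT (Vertex v)) / (2 * hT (Vertex u)))"
    by (rule divide_ennreal) (auto simp: hT_Vertex)
  also have "(2 * hT (Vertex v)) / (2 * hT (Vertex u)) = (1/2) ^ (length v - length u)"
    using p by (simp add: power_diff)
  finally show ?thesis .
qed

text \<open>By \<open>chain\<close>, a common point of two successor sets would make their vertices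
  comparable.\<close>

lemma emeasure_spread_incomparable:
  assumes "\<not> Vertex v \<le> Vertex u" "\<not> Vertex u \<le> Vertex v"
  shows "emeasure (spread (Vertex u)) (Sset (Vertex v)) = 0"
proof -
  have "bSset (Vertex u) \<inter> Sset (Vertex v) = {}"
    using assms chain by (auto simp: bSset_def Sset_def simp del: tbar_le_simps)
  then show ?thesis by (simp add: emeasure_spread_Vertex)
qed

section \<open>Comparison of the one-dimensional kernels\<close>

lemma inj_on_depth_ancestors: "inj_on depth (ancestors a)"
proof (rule inj_onI)
  fix b c assume bc: "b \<in> ancestors a" "c \<in> ancestors a" "depth b = depth c"
  then obtain u v where uv: "b = Vertex u" "c = Vertex v" by (auto simp: tverts_def)
  \<comment> \<open>Both vertices lie above \<open>a\<close>, hence on one path, where the depth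
    determines the vertex.\<close>
  have "prefix u v \<or> prefix v u" using chain[of a b c] bc uv by auto
  then show "b = c" using bc uv by (auto elim!: prefixE)
qed

text \<open>Injectivity of \<open>g\<close> allows reindexing by distinct exponents, which leaves a
  subseries of the geometric series.\<close>

lemma nn_integral_geometric_le:
  fixes g :: "'a \<Rightarrow> nat"
  assumes "0 \<le> r" "r < 1" "inj_on g A"
  shows "(\<integral>\<^sup>+ c. ennreal (r ^ g c) \<partial>count_space A) \<le> ennreal (1 / (1 - r))"
proof -
  have "(\<integral>\<^sup>+ c. ennreal (r ^ g c) \<partial>count_space A) = (\<integral>\<^sup>+ n. ennreal (r ^ n) \<partial>count_space (g ` A))"
    using assms by (intro nn_integral_bij_count_space) (simp add: bij_betw_def)
  also have "\<dots> = (\<integral>\<^sup>+ n. ennreal (r ^ n) * indicator (g ` A) n \<partial>count_space UNIV)"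
    by (simp add: nn_integral_count_space_indicator)
  also have "\<dots> \<le> (\<integral>\<^sup>+ n. ennreal (r ^ n) \<partial>count_space UNIV)"
    by (intro nn_integral_mono) (simp add: indicator_def)
  also have "\<dots> = (\<Sum>n. ennreal (r ^ n))" by (rule nn_integral_count_space_nat)
  also have "\<dots> = ennreal (1 / (1 - r))"
    using assms by (intro suminf_ennreal_eq geometric_sums) auto
  finally show ?thesis .
qed

text \<open>Each level below \<open>u\<close> halves the spread mass and multiplies the weight by
  \<open>2 powr s\<close>, so the terms decay with ratio \<open>2 powr (s - 1)\<close>, which is
  less than 1. Each depth contributes at most one ancestor \<open>c\<close> of
  \<open>a\<close>.\<close>

lemma nn_integral_spread_below_le:
  fixes s :: real
  assumes s: "s < 1"
  shows "(\<integral>\<^sup>+ c. emeasure (spread (Vertex u)) (Sset c) * ennreal (vertex_weight s c)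
             \<partial>count_space {c \<in> ancestors a. c < Vertex u})
    \<le> ennreal (1 / (1 - 2 powr (s - 1))) * ennreal (vertex_weight s (Vertex u))"
proof -
  let ?A = "{c \<in> ancestors a. c < Vertex u}"
  let ?r = "2 powr (s - 1)"
  let ?w = "vertex_weight s (Vertex u)"
  \<comment> \<open>The number of levels from \<open>u\<close> down to \<open>c\<close>; the depth
    of \<open>u\<close> is \<open>Suc (length u)\<close> because the root is counted. By
    \<open>deep\<close> the truncated subtraction is exact on \<open>?A\<close>, so
    \<open>?g\<close> inherits the injectivity of \<open>depth\<close>.\<close>
  let ?g = "\<lambda>c. depth c - Suc (length u)"
  have deep: "Suc (length u) \<le> depth c" if "c \<in> ?A" for c
    using that by (auto simp: tverts_def less_le prefix_length_le)
  have "emeasure (spread (Vertex u)) (Sset c) * ennreal (vertex_weight s c)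
      = ennreal ?w * ennreal (?r ^ ?g c)" if c: "c \<in> ?A" for c
  proof -
    obtain v where v: "c = Vertex v" using c by (auto simp: tverts_def)
    define k where "k = length v - length u"
    have l: "length v = length u + k" using deep[OF c] v by (simp add: k_def)
    have half: "(1/2::real) ^ k = 2 powr (- real k)"
      using powr_realpow[of "2::real" k] by (simp add: powr_minus_divide power_one_over)
    have r: "?r ^ k = 2 powr ((s - 1) * real k)"
      using powr_realpow[of ?r k] by (simp add: powr_powr)
    \<comment> \<open>Exponents of 2: the mass contributes \<open>- real k\<close> and the weight
      the rest; splitting off the weight of \<open>u\<close> leaves \<open>s - 1\<close> per
      level.\<close>
    have "- real k + s * real (Suc (length v)) = s * real (Suc (length u)) + (s - 1) * real k"
      by (simp add: l algebra_simps)
    then have "(1/2) ^ k * vertex_weight s c = ?w * ?r ^ k"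
      unfolding half r v by (simp only: dT_Vertex the_enat.simps powr_add[symmetric])
    moreover have "emeasure (spread (Vertex u)) (Sset c) = ennreal ((1/2) ^ k)"
      unfolding v k_def using c v by (intro emeasure_spread_descendant) (simp add: less_le)
    moreover have "?g c = k" by (simp add: v l)
    ultimately show ?thesis by (simp flip: ennreal_mult)
  qed
  then have "(\<integral>\<^sup>+ c. emeasure (spread (Vertex u)) (Sset c) * ennreal (vertex_weight s c) \<partial>count_space ?A)
      = (\<integral>\<^sup>+ c. ennreal ?w * ennreal (?r ^ ?g c) \<partial>count_space ?A)"
    by (intro nn_integral_cong) simp
  also have "\<dots> = ennreal ?w * (\<integral>\<^sup>+ c. ennreal (?r ^ ?g c) \<partial>count_space ?A)"
    by (rule nn_integral_cmult) simp
  also have "\<dots> \<le> ennreal ?w * ennreal (1 / (1 - ?r))"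
  proof (intro mult_left_mono nn_integral_geometric_le)
    have "2 powr (s - 1) < 2 powr 0" using s by (intro powr_less_mono) auto
    then show "?r < 1" by simp
    show "inj_on ?g ?A"
    proof (rule inj_onI)
      fix b c assume bc: "b \<in> ?A" "c \<in> ?A" "?g b = ?g c"
      then have "depth b = depth c" using deep by (metis le_add_diff_inverse)
      then show "b = c" using bc inj_on_depth_ancestors[of a] by (auto dest: inj_onD)
    qed
  qed auto
  finally show ?thesis by (simp add: mult.commute)
qed

text \<open>The comparison holds term by term: where the indicator is 1, \<open>t\<close> lies below
  \<open>c\<close> and \<open>spread t\<close> gives \<open>Sset c\<close> full mass.\<close>

lemma kernel_le_spread_kernel:
  "(\<integral>\<^sup>+ c. indicator (Sset c) t * ennreal (vertex_weight s c) \<partial>count_space (ancestors a))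
    \<le> (\<integral>\<^sup>+ c. emeasure (spread t) (Sset c) * ennreal (vertex_weight s c) \<partial>count_space (ancestors a))"
proof (intro nn_integral_mono mult_right_mono)
  fix c assume "c \<in> space (count_space (ancestors a))"
  then obtain v where "c = Vertex v" by (auto simp: tverts_def)
  then show "indicator (Sset c) t \<le> emeasure (spread t) (Sset c)"
    using emeasure_spread_ancestor[of t v] by (auto simp: indicator_def Sset_def)
qed simp

text \<open>In the constant, the 1 accounts for the ancestors of \<open>t\<close>, where both
  kernels have the same terms, and the fraction for the vertices strictly below
  \<open>t\<close>.\<close>

lemma spread_kernel_le_kernel:
  fixes s :: real
  assumes s: "s < 1"
  shows "(\<integral>\<^sup>+ c. emeasure (spread t) (Sset c) * ennreal (vertex_weight s c) \<partial>count_space (ancestors a))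
    \<le> ennreal (1 + 1 / (1 - 2 powr (s - 1)))
        * (\<integral>\<^sup>+ c. indicator (Sset c) t * ennreal (vertex_weight s c) \<partial>count_space (ancestors a))"
    (is "?B \<le> ennreal (1 + ?D) * ?A")
proof -
  have "2 powr (s - 1) < 2 powr 0" using s by (intro powr_less_mono) auto
  then have D: "0 \<le> ?D" by simp
  have D1: "ennreal (1 + ?D) = 1 + ennreal ?D" using D by simp
  show ?thesis
  proof (cases t)
    case (Ray \<omega>)
    \<comment> \<open>The spread of a ray is its point mass, so the two kernels agree.\<close>
    have "?B = ?A"
      by (intro nn_integral_cong)
        (use Ray in \<open>auto simp: emeasure_spread_Ray tverts_def\<close>)
    then show ?thesis by (simp add: D1 distrib_right)
  next
    case (Vertex u)
    let ?f = "\<lambda>c. emeasure (spread t) (Sset c) * ennreal (vertex_weight s c)"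
    let ?E = "\<integral>\<^sup>+ c. ?f c \<partial>count_space {c \<in> ancestors a. c < t}"
    \<comment> \<open>The terms agree when \<open>t \<le> c\<close> (full mass) and when
      \<open>c\<close> and \<open>t\<close> are incomparable (no mass); the excess consists exactly
      of the terms with \<open>c < t\<close>.\<close>
    have "?f c = indicator (Sset c) t * ennreal (vertex_weight s c) + ?f c * indicator {..<t} c"
      if c: "c \<in> ancestors a" for c
    proof -
      obtain v where v: "c = Vertex v" using c by (auto simp: tverts_def)
      consider "t \<le> c" | "c < t" | "\<not> c \<le> t" "\<not> t \<le> c" by (auto simp: less_le)
      then show ?thesis
      proof cases
        case 1
        then have "\<not> c < t" by auto
        then show ?thesis using 1 v emeasure_spread_ancestor[of t v] by (simp add: Sset_def)
      next
        case 2
        then have "\<not> t \<le> c" by auto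
        then show ?thesis using 2 by (simp add: Sset_def)
      next
        case 3
        then show ?thesis using emeasure_spread_incomparable[of v u] v Vertex by (simp add: Sset_def)
      qed
    qed
    then have "?B = (\<integral>\<^sup>+ c. indicator (Sset c) t * ennreal (vertex_weight s c)
        + ?f c * indicator {..<t} c \<partial>count_space (ancestors a))"
      by (intro nn_integral_cong) simp
    also have "\<dots> = ?A + (\<integral>\<^sup>+ c. ?f c * indicator {..<t} c \<partial>count_space (ancestors a))"
      by (rule nn_integral_add) auto
    also have "(\<integral>\<^sup>+ c. ?f c * indicator {..<t} c \<partial>count_space (ancestors a)) = ?E"
      by (auto simp: nn_integral_count_space_indicator indicator_def intro!: nn_integral_cong)
    also have "?E \<le> ennreal ?D * ?A"
    \<comment> \<open>If \<open>a \<le> t\<close>, then \<open>t\<close> is a common ancestor of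
      \<open>a\<close> and itself, so its weight is one term of \<open>?A\<close> and bounds the
      whole excess up to the factor \<open>?D\<close>. Otherwise no \<open>c\<close> satisfies
      \<open>a \<le> c < t\<close>, and there is no excess.\<close>
    proof (cases "a \<le> t")
      case True
      then have t: "t \<in> ancestors a" using Vertex by (simp add: tverts_def)
      have "?E \<le> ennreal ?D * ennreal (vertex_weight s t)"
        unfolding Vertex by (rule nn_integral_spread_below_le[OF s])
      also have "ennreal (vertex_weight s t) = indicator (Sset t) t * ennreal (vertex_weight s t)"
        by (simp add: Sset_def)
      also have "\<dots> \<le> ?A" using t by (intro nn_integral_ge_point)
      finally show ?thesis by (simp add: mult_left_mono)
    next
      case False
      then have "{c \<in> ancestors a. c < t} = {}" using order.strict_implies_order order_trans by blast
      then have "?E = 0" by (simp add: nn_integral_empty)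
      then show ?thesis by simp
    qed
    finally show ?thesis by (simp add: D1 distrib_right add_left_mono)
  qed
qed

section \<open>Measurability and factorization over the coordinates\<close>

lemma borel_measurable_nn_integral_countable:
  assumes A: "countable A" and f: "\<And>c. c \<in> A \<Longrightarrow> (\<lambda>x. f x c) \<in> borel_measurable M"
  shows "(\<lambda>x. \<integral>\<^sup>+ c. f x c \<partial>count_space A) \<in> borel_measurable M"
proof (rule sigma_finite_measure.borel_measurable_nn_integral)
  show "sigma_finite_measure (count_space A)"
    using A by (rule sigma_finite_measure_count_space_countable)
  \<comment> \<open>Joint measurability: \<open>f\<close> is measurable in \<open>x\<close> for each
    fixed index, and a measurable selection among countably many such functions is
    measurable.\<close>
  have "(\<lambda>p. f (fst p) c) \<in> borel_measurable (M \<Otimes>\<^sub>M count_space A)" if "c \<in> A" for c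
    using measurable_fst f[OF that] by (rule measurable_compose)
  then show "case_prod f \<in> borel_measurable (M \<Otimes>\<^sub>M count_space A)"
    unfolding case_prod_beta' using measurable_snd A
    by (rule measurable_compose_countable'[where f = "\<lambda>c p. f (fst p) c" and g = snd])
qed

lemma borel_measurable_coordinate:
  assumes "sets \<mu> = sets (borel :: ('n::finite \<Rightarrow> tbar) measure)"
  shows "(\<lambda>\<tau>. \<tau> j) \<in> borel_measurable \<mu>"
  unfolding measurable_cong_sets[OF assms refl]
  by (rule borel_measurable_continuous_onI) (intro continuous_on_product_coordinates)

lemma countable_ancestors: "countable (ancestors a)"
  using countable_tverts by (rule countable_subset[rotated]) auto

lemma borel_measurable_kernel:
  assumes "sets \<mu> = sets (borel :: ('n::finite \<Rightarrow> tbar) measure)"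
  shows "(\<lambda>\<tau>. \<integral>\<^sup>+ c. indicator (Sset c) (\<tau> j) * ennreal (vertex_weight s c) \<partial>count_space (ancestors a))
    \<in> borel_measurable \<mu>"
proof (rule measurable_compose[OF borel_measurable_coordinate[OF assms]])
  show "(\<lambda>t. \<integral>\<^sup>+ c. indicator (Sset c) t * ennreal (vertex_weight s c) \<partial>count_space (ancestors a))
    \<in> borel_measurable borel"
    by (intro borel_measurable_nn_integral_countable[OF countable_ancestors]) (auto simp: tverts_def)
qed

text \<open>The general \<open>q\<close> serves both potentials: it becomes the indicator of a
  successor set or the spread mass of that set.\<close>

lemma nn_integral_product_kernel:
  fixes \<mu> :: "('n::finite \<Rightarrow> tbar) measure"
  assumes \<mu>: "sets \<mu> = sets borel"
    and q: "\<And>c. c \<in> tverts \<Longrightarrow> (\<lambda>t. q t c) \<in> borel_measurable borel"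
  shows "(\<integral>\<^sup>+ \<gamma>. (\<integral>\<^sup>+ \<tau>. (\<Prod>j\<in>UNIV. q (\<tau> j) (\<gamma> j)) \<partial>\<mu>) * ennreal (poly_weight s \<gamma>)
             \<partial>count_space {\<gamma> \<in> Tprod. \<alpha> \<le> \<gamma>})
    = (\<integral>\<^sup>+ \<tau>. (\<Prod>j\<in>UNIV. \<integral>\<^sup>+ c. q (\<tau> j) c * ennreal (vertex_weight (s j) c)
             \<partial>count_space (ancestors (\<alpha> j))) \<partial>\<mu>)"
proof -
  let ?X = "\<lambda>j. ancestors (\<alpha> j)"
  let ?f = "\<lambda>\<tau> j c. q (\<tau> j) c * ennreal (vertex_weight (s j) c)"
  have X: "{\<gamma> \<in> Tprod. \<alpha> \<le> \<gamma>} = PiE UNIV ?X" by (auto simp: Tprod_def le_fun_def PiE_def)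
  note cX = countable_ancestors
  then have cP: "countable (PiE UNIV ?X)" by (intro countable_PiE) auto
  have w: "ennreal (poly_weight s \<gamma>) = (\<Prod>j\<in>UNIV. ennreal (vertex_weight (s j) (\<gamma> j)))" for \<gamma>
    unfolding poly_weight_def by (rule prod_ennreal[symmetric]) simp
  have m: "(\<lambda>\<tau>. \<Prod>j\<in>UNIV. q (\<tau> j) (\<gamma> j)) \<in> borel_measurable \<mu>" if "\<gamma> \<in> PiE UNIV ?X" for \<gamma>
  proof -
    have "(\<lambda>t. q t (\<gamma> j)) \<in> borel_measurable borel" for j
      using that by (intro q) auto
    with borel_measurable_coordinate[OF \<mu>] have "(\<lambda>\<tau>. q (\<tau> j) (\<gamma> j)) \<in> borel_measurable \<mu>" for j
      by (rule measurable_compose)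
    then show ?thesis by (rule borel_measurable_prod_ennreal)
  qed
  have "(\<integral>\<^sup>+ \<gamma>. (\<integral>\<^sup>+ \<tau>. (\<Prod>j\<in>UNIV. q (\<tau> j) (\<gamma> j)) \<partial>\<mu>) * ennreal (poly_weight s \<gamma>)
      \<partial>count_space (PiE UNIV ?X))
    = (\<integral>\<^sup>+ \<gamma>. (\<integral>\<^sup>+ \<tau>. (\<Prod>j\<in>UNIV. ?f \<tau> j (\<gamma> j)) \<partial>\<mu>) \<partial>count_space (PiE UNIV ?X))"
    by (intro nn_integral_cong) (simp add: w m prod.distrib nn_integral_multc)
  \<comment> \<open>Tonelli for a countable sum and an arbitrary measure
    \<open>\<mu>\<close>.\<close>
  also have "\<dots> = (\<integral>\<^sup>+ \<tau>. (\<integral>\<^sup>+ \<gamma>. (\<Prod>j\<in>UNIV. ?f \<tau> j (\<gamma> j)) \<partial>count_space (PiE UNIV ?X)) \<partial>\<mu>)"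
    by (rule nn_integral_count_space_nn_integral[OF cP, symmetric])
      (use m in \<open>simp add: prod.distrib\<close>)
  also have "\<dots> = (\<integral>\<^sup>+ \<tau>. (\<Prod>j\<in>UNIV. \<integral>\<^sup>+ c. ?f \<tau> j c \<partial>count_space (?X j)) \<partial>\<mu>)"
  proof (intro nn_integral_cong)
    fix \<tau>
    interpret product_sigma_finite "\<lambda>j. count_space (?X j)"
      by (simp add: product_sigma_finite_def sigma_finite_measure_count_space_countable cX)
    \<comment> \<open>Counting measure on a finite product of countable sets is the product measure,
      so Fubini turns the sum of products into a product of sums.\<close>
    have "PiM UNIV (\<lambda>j. count_space (?X j)) = count_space (PiE UNIV ?X)"
      by (rule count_space_PiM_finite) (use cX in auto)
    then show "(\<integral>\<^sup>+ \<gamma>. (\<Prod>j\<in>UNIV. ?f \<tau> j (\<gamma> j)) \<partial>count_space (PiE UNIV ?X))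
        = (\<Prod>j\<in>UNIV. \<integral>\<^sup>+ c. ?f \<tau> j c \<partial>count_space (?X j))"
      using product_nn_integral_prod[of UNIV "?f \<tau>"] by simp
  qed
  finally show ?thesis by (simp only: X)
qed

section \<open>Both potentials as integrals of product kernels\<close>

lemma potential_eq:
  fixes \<mu> :: "('n::finite \<Rightarrow> tbar) measure"
  assumes \<mu>: "sets \<mu> = sets poly_borel"
  shows "potential (poly_weight s) \<mu> \<alpha>
    = (\<integral>\<^sup>+ \<tau>. (\<Prod>j\<in>UNIV. \<integral>\<^sup>+ c. indicator (Sset c) (\<tau> j) * ennreal (vertex_weight (s j) c)
             \<partial>count_space (ancestors (\<alpha> j))) \<partial>\<mu>)"
proof -
  \<comment> \<open>The order is coordinatewise, so the indicator of \<open>Sset \<gamma>\<close> is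
    a product: one failing coordinate makes it vanish.\<close>
  have "I_adj \<mu> \<gamma> = (\<integral>\<^sup>+ \<tau>. (\<Prod>j\<in>UNIV. indicator (Sset (\<gamma> j)) (\<tau> j)) \<partial>\<mu>)" if "\<gamma> \<in> Tprod" for \<gamma>
  proof -
    have "(\<Prod>j\<in>UNIV. indicator (Sset (\<gamma> j)) (\<tau> j)) = (indicator (Sset \<gamma>) \<tau> :: ennreal)" for \<tau>
    proof (cases "\<tau> \<in> Sset \<gamma>")
      case True
      then show ?thesis by (simp add: Sset_def le_fun_def)
    next
      case False
      then obtain j where "\<tau> j \<notin> Sset (\<gamma> j)" by (auto simp: Sset_def le_fun_def)
      then have "(\<Prod>j\<in>UNIV. indicator (Sset (\<gamma> j)) (\<tau> j)) = (0::ennreal)"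
        by (intro prod_zero bexI[of _ j]) auto
      then show ?thesis using False by simp
    qed
    then show ?thesis using Sset_measurable[OF that] \<mu> by (simp add: I_adj_def)
  qed
  then have "potential (poly_weight s) \<mu> \<alpha>
      = (\<integral>\<^sup>+ \<gamma>. (\<integral>\<^sup>+ \<tau>. (\<Prod>j\<in>UNIV. indicator (Sset (\<gamma> j)) (\<tau> j)) \<partial>\<mu>) * ennreal (poly_weight s \<gamma>)
          \<partial>count_space {\<gamma> \<in> Tprod. \<alpha> \<le> \<gamma>})"
    unfolding potential_def I_op_def by (intro nn_integral_cong) simp
  also have "\<dots> = (\<integral>\<^sup>+ \<tau>. (\<Prod>j\<in>UNIV. \<integral>\<^sup>+ c. indicator (Sset c) (\<tau> j) * ennreal (vertex_weight (s j) c)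
             \<partial>count_space (ancestors (\<alpha> j))) \<partial>\<mu>)"
    by (rule nn_integral_product_kernel[where q = "\<lambda>t c. indicator (Sset c) t"])
      (use \<mu> in \<open>auto simp: poly_borel_eq_borel tverts_def\<close>)
  finally show ?thesis .
qed

text \<open>For fixed \<open>\<tau>\<close> the successor set is a box and the measure spreading
  \<open>\<tau>\<close> is a product measure, so the mass factors.\<close>

lemma potential_push_down_eq:
  fixes \<mu> :: "('n::finite \<Rightarrow> tbar) measure"
  assumes \<mu>: "sets \<mu> = sets poly_borel"
  shows "potential (poly_weight s) (push_down \<mu>) \<alpha>
    = (\<integral>\<^sup>+ \<tau>. (\<Prod>j\<in>UNIV. \<integral>\<^sup>+ c. emeasure (spread (\<tau> j)) (Sset c) * ennreal (vertex_weight (s j) c)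
             \<partial>count_space (ancestors (\<alpha> j))) \<partial>\<mu>)"
proof -
  have "I_adj (push_down \<mu>) \<gamma>
      = (\<integral>\<^sup>+ \<tau>. (\<Prod>j\<in>UNIV. emeasure (spread (\<tau> j)) (Sset (\<gamma> j))) \<partial>\<mu>)" if \<gamma>: "\<gamma> \<in> Tprod" for \<gamma>
  proof -
    have "emeasure (\<Pi>\<^sub>M j\<in>UNIV. spread (\<tau> j)) (Sset \<gamma>)
        = (\<Prod>j\<in>UNIV. emeasure (spread (\<tau> j)) (Sset (\<gamma> j)))" for \<tau>
    proof -
      interpret product_prob_space "\<lambda>j. spread (\<tau> j)" "UNIV :: 'n set"
        by (intro product_prob_spaceI prob_space_spread)
      have "Sset \<gamma> = PiE UNIV (\<lambda>j. Sset (\<gamma> j))" by (auto simp: Sset_def le_fun_def)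
      moreover have "Sset (\<gamma> j) \<in> sets borel" for j
      proof -
        obtain v where "\<gamma> j = Vertex v" using \<gamma> by (auto simp: Tprod_def tverts_def)
        then show ?thesis using Sset_Vertex_borel by simp
      qed
      ultimately show ?thesis using emeasure_PiM[of UNIV "\<lambda>j. Sset (\<gamma> j)"] by simp
    qed
    then show ?thesis unfolding I_adj_def
      by (simp add: emeasure_push_down[OF \<mu> Sset_measurable[OF \<gamma>]])
  qed
  then have "potential (poly_weight s) (push_down \<mu>) \<alpha>
      = (\<integral>\<^sup>+ \<gamma>. (\<integral>\<^sup>+ \<tau>. (\<Prod>j\<in>UNIV. emeasure (spread (\<tau> j)) (Sset (\<gamma> j))) \<partial>\<mu>)
          * ennreal (poly_weight s \<gamma>) \<partial>count_space {\<gamma> \<in> Tprod. \<alpha> \<le> \<gamma>})"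
    unfolding potential_def I_op_def by (intro nn_integral_cong) simp
  also have "\<dots> = (\<integral>\<^sup>+ \<tau>. (\<Prod>j\<in>UNIV. \<integral>\<^sup>+ c. emeasure (spread (\<tau> j)) (Sset c)
      * ennreal (vertex_weight (s j) c) \<partial>count_space (ancestors (\<alpha> j))) \<partial>\<mu>)"
    by (rule nn_integral_product_kernel[where q = "\<lambda>t c. emeasure (spread t) (Sset c)"])
      (use \<mu> in \<open>auto simp: poly_borel_eq_borel tverts_def intro!: measurable_spread\<close>)
  finally show ?thesis .
qed

section \<open>Multiplying the one-dimensional estimates over the coordinates\<close>

theorem theorem3p1:
  fixes s :: "'n::finite \<Rightarrow> real"
    and \<pi> :: "('n \<Rightarrow> tbar) \<Rightarrow> real"
  assumes "\<And>j. 0 \<le> s j" and "\<And>j. s j < 1"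
    and "\<pi> = poly_weight s"
  shows "\<exists>C::real. 1 \<le> C \<and>
    (\<forall>\<mu> :: ('n \<Rightarrow> tbar) measure.
       sets \<mu> = sets poly_borel \<longrightarrow> energy \<pi> \<mu> < \<infinity> \<longrightarrow>
       (\<forall>\<alpha>. ennreal (1 / C) * potential \<pi> (push_down \<mu>) \<alpha> \<le> potential \<pi> \<mu> \<alpha> \<and>
            potential \<pi> \<mu> \<alpha> \<le> ennreal C * potential \<pi> (push_down \<mu>) \<alpha>))"
proof -
  \<comment> \<open>The constant lost in coordinate \<open>j\<close>. Kernels multiply over the
    coordinates, and so do these constants; they depend on \<open>s\<close> alone, so
    \<open>C\<close> is fixed before \<open>\<mu>\<close> and \<open>\<alpha>\<close>.\<close>
  let ?D = "\<lambda>j. 1 + 1 / (1 - 2 powr (s j - 1))"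
  define C where "C = (\<Prod>j\<in>UNIV. ?D j)"
  have D: "1 \<le> ?D j" for j
  proof -
    have "2 powr (s j - 1) < 2 powr 0" using assms(2)[of j] by (intro powr_less_mono) auto
    then show ?thesis by simp
  qed
  then have C: "1 \<le> C" unfolding C_def by (intro prod_ge_1)
  have "ennreal (1 / C) * potential \<pi> (push_down \<mu>) \<alpha> \<le> potential \<pi> \<mu> \<alpha>"
    and "potential \<pi> \<mu> \<alpha> \<le> ennreal C * potential \<pi> (push_down \<mu>) \<alpha>"
    if \<mu>: "sets \<mu> = sets poly_borel" for \<mu> \<alpha>
  proof -
    let ?A = "\<lambda>\<tau> j. \<integral>\<^sup>+ c. indicator (Sset c) (\<tau> j) * ennreal (vertex_weight (s j) c)
        \<partial>count_space (ancestors (\<alpha> j))"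
    let ?B = "\<lambda>\<tau> j. \<integral>\<^sup>+ c. emeasure (spread (\<tau> j)) (Sset c) * ennreal (vertex_weight (s j) c)
        \<partial>count_space (ancestors (\<alpha> j))"
    note V = potential_eq[OF \<mu>, of s \<alpha>] potential_push_down_eq[OF \<mu>, of s \<alpha>]
    \<comment> \<open>This direction holds with constant 1, the kernels being ordered in every
      coordinate.\<close>
    have "potential \<pi> \<mu> \<alpha> \<le> potential \<pi> (push_down \<mu>) \<alpha>"
      unfolding assms(3) V
      by (intro nn_integral_mono prod_mono_ennreal kernel_le_spread_kernel)
    also have "\<dots> \<le> ennreal C * potential \<pi> (push_down \<mu>) \<alpha>"
      using mult_right_mono[of 1 "ennreal C"] C by simp
    finally show "potential \<pi> \<mu> \<alpha> \<le> ennreal C * potential \<pi> (push_down \<mu>) \<alpha>" .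
    have "(\<Prod>j\<in>UNIV. ?B \<tau> j) \<le> ennreal C * (\<Prod>j\<in>UNIV. ?A \<tau> j)" for \<tau>
    proof -
      have "(\<Prod>j\<in>UNIV. ?B \<tau> j) \<le> (\<Prod>j\<in>UNIV. ennreal (?D j) * ?A \<tau> j)"
        by (intro prod_mono_ennreal spread_kernel_le_kernel assms(2))
      also have "\<dots> = (\<Prod>j\<in>UNIV. ennreal (?D j)) * (\<Prod>j\<in>UNIV. ?A \<tau> j)" by (rule prod.distrib)
      also have "(\<Prod>j\<in>UNIV. ennreal (?D j)) = ennreal C"
        unfolding C_def using D by (intro prod_ennreal) (meson order_trans zero_le_one)
      finally show ?thesis .
    qed
    then have "potential \<pi> (push_down \<mu>) \<alpha> \<le> (\<integral>\<^sup>+ \<tau>. ennreal C * (\<Prod>j\<in>UNIV. ?A \<tau> j) \<partial>\<mu>)"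
      unfolding assms(3) V by (intro nn_integral_mono)
    also have "\<dots> = ennreal C * potential \<pi> \<mu> \<alpha>"
      unfolding assms(3) V
      using borel_measurable_kernel \<mu>
      by (intro nn_integral_cmult borel_measurable_prod_ennreal) (simp add: poly_borel_eq_borel)
    finally have "ennreal (1 / C) * potential \<pi> (push_down \<mu>) \<alpha>
        \<le> ennreal (1 / C) * (ennreal C * potential \<pi> \<mu> \<alpha>)"
      by (rule mult_left_mono) simp
    \<comment> \<open>\<open>C\<close> is a positive real, so \<open>1 / C\<close> cancels it in
      \<open>ennreal\<close> even where the potential is infinite.\<close>
    also have "\<dots> = potential \<pi> \<mu> \<alpha>" using C by (simp add: mult.assoc[symmetric] flip: ennreal_mult)
    finally show "ennreal (1 / C) * potential \<pi> (push_down \<mu>) \<alpha> \<le> potential \<pi> \<mu> \<alpha>" .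
  qed
  then show ?thesis using C by blast
qed

end
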